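(* Let $\Delta t_m>0$, let $\vec X^m\in \underline V^h_{\partial_0}$, and let $(\vec X^{m+1},\varkappa^{m+1})$, with $\vec X^{m+1}-\vec X^m\in\underline V^h_{\partial}$ and $\varkappa^{m+1}\in V^h$, be a solution of the fully discrete scheme $$\frac{1}{\Delta t_m}\bigl\langle \vec X^{m+1}-\vec X^m,\ \chi\,\vec f^{\,m+\frac12}\bigr\rangle-\bigl\langle (\vec X^m\cdot\vec e_1)\,\varkappa^{m+1},\ \chi\,|\vec X^m_\rho|\bigr\rangle+\frac{\langle\vec X^m\cdot\vec e_1,\ \varkappa^{m+1}|\vec X^m_\rho|\rangle}{\langle\vec X^m\cdot\vec e_1,\ |\vec X^m_\rho|\rangle}\,\bigl\langle\vec X^m\cdot\vec e_1,\ \chi\,|\vec X^m_\rho|\bigr\rangle=0\qquad\forall\,\chi\in V^h,$$ $$\bigl\langle \varkappa^{m+1}\,\vec f^{\,m+\frac12},\ \vec\eta\bigr\rangle+\bigl\langle \vec\eta\cdot\vec e_1,\ |\vec X^{m+1}_\rho|\bigr\rangle+\bigl\langle (\vec X^m\cdot\vec e_1)\,\vec X^{m+1}_\rho,\ \vec\eta_\rho\,|\vec X^m_\rho|^{-1}\bigr\rangle=0\qquad\forall\,\vec\eta\in\underline V^h_{\partial}.$$ Then $$\frac1{2\pi}A(\vec X^m)-\frac1{2\pi}A(\vec X^{m+1})\ \ge\ \Delta t_m\bigl\langle (\vec X^m\cdot\vec e_1)\,|\varkappa^{m+1}|^2,\ |\vec X^m_\rho|\bigr\rangle-\Delta t_m\frac{\bigl(\langle\vec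 X^m\cdot\vec e_1,\ \varkappa^{m+1}|\vec X^m_\rho|\rangle\bigr)^2}{\langle\vec X^m\cdot\vec e_1,\ |\vec X^m_\rho|\rangle}\ \ge\ 0.$$ Moreover, $M(\vec X^{m+1})=M(\vec X^m)$.
   Context: Domain and boundary. Either $\mathbb I=\mathbb R/\mathbb Z$ (with $\partial\mathbb I=\emptyset$) or $\mathbb I=(0,1)$ (with $\partial\mathbb I=\{0,1\}$). $\partial\mathbb I=\partial_D\mathbb I\cup\partial_0\mathbb I\cup\partial_1\mathbb I\cup\partial_2\mathbb I$ is a given disjoint partition. $\vec e_1,\vec e_2$ is the standard basis of $\mathbb R^2$; $\langle\cdot,\cdot\rangle$ is the $L^2$ inner product over $\mathbb I$ (scalar or vector valued); subscript $\rho$ is the derivative on $\mathbb I$ (piecewise for finite element functions); $(a,b)^\perp=(b,-a)$ is clockwise rotation by $\pi/2$. Finite element spaces. For an integer $J\ge3$, $h=1/J$, $q_j=jh$, $\mathbb I_j=[q_{j-1},q_j]$. $V^h$ is the space of continuous functions on $\overline{\mathbb I}$ that are affine on each $\mathbb I_j$ (periodic if $\mathbb I=\mathbb R/\mathbb Z$). $\underline V^h_{\partial_0}=\{\vec\eta\in[V^h]^2:\vec\eta(\rho)\cdot\vec e_1=0\ \forall\rho\in\partial_0\mathbb I\}$, and $\underline V^h_{\partial}=\{\vec\eta\in\underline V^h_{\partial_0}:\vec\eta(\rho)\cdot\vec e_i=0\ \forall\rho\in\partial_i\mathbb I,\ i=1,2;\ \vec\eta(\rho)=\vec 0\ \forall\rho\in\partial_D\mathbb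 I\}$. Standing assumptions. For $\vec X\in\{\vec X^m,\vec X^{m+1}\}$: $\vec X\cdot\vec e_1>0$ in $\overline{\mathbb I}\setminus\partial_0\mathbb I$ and $|\vec X_\rho|>0$ in $\mathbb I$ (on each element). $\vec X$ parameterizes the generating curve of a surface rotationally symmetric about the $x_2$-axis. Time-averaged weighted normal: $$\vec f^{\,m+\frac12}=-\tfrac16\Bigl(2(\vec X^m\cdot\vec e_1)\vec X^m_\rho+2(\vec X^{m+1}\cdot\vec e_1)\vec X^{m+1}_\rho+(\vec X^m\cdot\vec e_1)\vec X^{m+1}_\rho+(\vec X^{m+1}\cdot\vec e_1)\vec X^m_\rho\Bigr)^\perp .$$ Surface area: $A(\vec X)=2\pi\int_{\mathbb I}(\vec X\cdot\vec e_1)\,|\vec X_\rho|\,d\rho$. Enclosed volume (up to an additive constant): $M(\vec X)=\pi\langle(\vec X\cdot\vec e_1)^2\,\vec\nu,\ \vec e_1\,|\vec X_\rho|\rangle+\pi\sum_{p\in\partial_1\mathbb I}(-1)^{p+1}(\vec X(p)\cdot\vec e_1)^2\,\vec X(p)\cdot\vec e_2$, where $\vec\nu=-|\vec X_\rho|^{-1}(\vec X_\rho)^\perp$ is the unit normal (the parameterization being oriented so that $\vec\nu$ is the outer normal). *)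

theory Defs
  imports "HOL-Analysis.Analysis"
begin

(* Functions on the closure of the domain are modelled as functions on real, of which only the
   values on {0..1} matter.  On the circle R/Z the points 0 and 1 are identified, so a function
   there is one with equal values at 0 and 1 (see fe_space). *)
datatype curve_domain = Circle | Unit_Interval

fun bdry :: "curve_domain \<Rightarrow> real set" where
  "bdry Circle = {}"
| "bdry Unit_Interval = {0, 1}"

definition bdry_partition ::
  "curve_domain \<Rightarrow> real set \<Rightarrow> real set \<Rightarrow> real set \<Rightarrow> real set \<Rightarrow> bool" where
  "bdry_partition \<Omega> dD d0 d1 d2 \<longleftrightarrow>
     bdry \<Omega> = dD \<union> d0 \<union> d1 \<union> d2 \<and>
     dD \<inter> d0 = {} \<and> dD \<inter> d1 = {} \<and> dD \<inter> d2 = {} \<and>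
     d0 \<inter> d1 = {} \<and> d0 \<inter> d2 = {} \<and> d1 \<inter> d2 = {}"

definition node :: "nat \<Rightarrow> nat \<Rightarrow> real" where
  "node J j = real j * (1 / real J)"

definition affine_fun_on :: "real set \<Rightarrow> (real \<Rightarrow> real) \<Rightarrow> bool" where
  "affine_fun_on S f \<longleftrightarrow> (\<exists>a b. \<forall>\<rho>\<in>S. f \<rho> = a + b * \<rho>)"

definition fe_space :: "curve_domain \<Rightarrow> nat \<Rightarrow> (real \<Rightarrow> real) set" where
  "fe_space \<Omega> J =
     {f. continuous_on {0..1} f \<and>
         (\<forall>j\<in>{1..J}. affine_fun_on {node J (j - 1)..node J j} f) \<and>
         (\<Omega> = Circle \<longrightarrow> f 0 = f 1)}"

definition fe_space2 :: "curve_domain \<Rightarrow> nat \<Rightarrow> (real \<Rightarrow> real ^ 2) set" where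
  "fe_space2 \<Omega> J = {\<eta>. \<forall>i. (\<lambda>\<rho>. \<eta> \<rho> $ i) \<in> fe_space \<Omega> J}"

definition fe_space_d0 ::
  "curve_domain \<Rightarrow> nat \<Rightarrow> real set \<Rightarrow> (real \<Rightarrow> real ^ 2) set" where
  "fe_space_d0 \<Omega> J d0 = {\<eta> \<in> fe_space2 \<Omega> J. \<forall>\<rho>\<in>d0. \<eta> \<rho> $ 1 = 0}"

definition fe_space_d ::
  "curve_domain \<Rightarrow> nat \<Rightarrow> real set \<Rightarrow> real set \<Rightarrow> real set \<Rightarrow> real set
     \<Rightarrow> (real \<Rightarrow> real ^ 2) set" where
  "fe_space_d \<Omega> J dD d0 d1 d2 =
     {\<eta> \<in> fe_space_d0 \<Omega> J d0.
        (\<forall>\<rho>\<in>d1. \<eta> \<rho> $ 1 = 0) \<and> (\<forall>\<rho>\<in>d2. \<eta> \<rho> $ 2 = 0) \<and> (\<forall>\<rho>\<in>dD. \<eta> \<rho> = 0)}"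

(* The derivative in rho.  For finite element functions it is unspecified at the nodes where the
   function has a kink; these form a null set and do not affect the integrals below. *)
abbreviation drho :: "(real \<Rightarrow> 'a::real_normed_vector) \<Rightarrow> real \<Rightarrow> 'a" where
  "drho X \<rho> \<equiv> vector_derivative X (at \<rho>)"

definition l2_inner :: "(real \<Rightarrow> 'a::real_inner) \<Rightarrow> (real \<Rightarrow> 'a) \<Rightarrow> real" where
  "l2_inner u v = integral {0..1} (\<lambda>\<rho>. u \<rho> \<bullet> v \<rho>)"

definition perp :: "real ^ 2 \<Rightarrow> real ^ 2" where
  "perp v = vector [v $ 2, - (v $ 1)]"

definition admissible_curve :: "nat \<Rightarrow> real set \<Rightarrow> (real \<Rightarrow> real ^ 2) \<Rightarrow> bool" where
  "admissible_curve J d0 X \<longleftrightarrow>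
     (\<forall>\<rho>\<in>{0..1} - d0. X \<rho> $ 1 > 0) \<and>
     (\<forall>j\<in>{1..J}. \<forall>\<rho>\<in>{node J (j - 1)<..<node J j}. norm (drho X \<rho>) > 0)"

definition avg_normal ::
  "(real \<Rightarrow> real ^ 2) \<Rightarrow> (real \<Rightarrow> real ^ 2) \<Rightarrow> real \<Rightarrow> real ^ 2" where
  "avg_normal X Y \<rho> =
     - (1 / 6) *\<^sub>R perp (2 *\<^sub>R ((X \<rho> $ 1) *\<^sub>R drho X \<rho>) + 2 *\<^sub>R ((Y \<rho> $ 1) *\<^sub>R drho Y \<rho>)
                     + (X \<rho> $ 1) *\<^sub>R drho Y \<rho> + (Y \<rho> $ 1) *\<^sub>R drho X \<rho>)"

definition surface_area :: "(real \<Rightarrow> real ^ 2) \<Rightarrow> real" where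
  "surface_area X = 2 * pi * integral {0..1} (\<lambda>\<rho>. (X \<rho> $ 1) * norm (drho X \<rho>))"

definition unit_normal :: "(real \<Rightarrow> real ^ 2) \<Rightarrow> real \<Rightarrow> real ^ 2" where
  "unit_normal X \<rho> = - inverse (norm (drho X \<rho>)) *\<^sub>R perp (drho X \<rho>)"

(* The boundary points p are the reals 0 and 1, hence the conversion in the exponent of -1. *)
definition enclosed_volume :: "real set \<Rightarrow> (real \<Rightarrow> real ^ 2) \<Rightarrow> real" where
  "enclosed_volume d1 X =
     pi * l2_inner (\<lambda>\<rho>. (X \<rho> $ 1)^2 *\<^sub>R unit_normal X \<rho>) (\<lambda>\<rho>. norm (drho X \<rho>) *\<^sub>R axis 1 1)
     + pi * (\<Sum>p\<in>d1. (-1) ^ (nat \<lfloor>p\<rfloor> + 1) * (X p $ 1)^2 * (X p $ 2))"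

end

theory Submission
  imports Defs
begin

text \<open>
  The scheme is designed so that two test functions give everything.

  Energy. Test the first equation with \<open>\<kappa>\<close>, multiply it by \<open>dt\<close>, and test the second with the
  displacement \<open>Y - X\<close>. Both then contain the same term with the averaged normal; eliminating it
  identifies the dissipation with minus the two remaining terms of the second equation. The sum of
  these two terms is at least the increase of area, already pointwise (\<open>area_increment_le\<close>), because
  \<open>v \<bullet> (v - u) \<ge> |u| (|v| - |u|)\<close> for all vectors. Nonnegativity of the dissipation is the
  Cauchy-Schwarz inequality for the weight \<open>x |X'|\<close> (\<open>weighted_variance_nonneg\<close>), where \<open>x\<close> and \<open>y\<close>
  denote the radii, that is, the first components of \<open>X\<close> and \<open>Y\<close>.

  Volume. Test the first equation with the constant 1: the two curvature terms cancel, so the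
  displacement is orthogonal to the averaged normal. That normal is the average of the
  weighted normal \<open>- perp (x X')\<close> along the segment from \<open>X\<close> to \<open>Y\<close>, and since that
  normal is quadratic in the segment parameter, the average has the weights 2, 2, 1, 1 over 6. Hence the
  volume integrand changes by twice displacement times normal, up to the derivative of
  \<open>(x\<^sup>2 + x y + y\<^sup>2) / 3\<close> times the vertical displacement (\<open>volume_increment\<close>). The boundary values
  of this last function cancel the change of the boundary sum in the volume
  (\<open>volume_boundary_terms\<close>): at a point of \<open>d1\<close> the radii agree, and everywhere else on the
  boundary the radii or the vertical displacement vanish; on the circle the function is periodic.

  The analytic part only has to justify that all integrals split linearly and that the exceptional
  behaviour of derivatives at the nodes is invisible to them.
\<close>

section \<open>Functions that are continuous on each element\<close>

definition nodes :: "nat \<Rightarrow> real set" where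
  "nodes J = node J ` {..J}"

text \<open>The representative \<open>g\<close> may differ from \<open>f\<close> at the nodes, since derivatives of finite element
  functions have arbitrary values there.\<close>

definition elementwise_continuous :: "nat \<Rightarrow> (real \<Rightarrow> 'a::real_normed_vector) \<Rightarrow> bool" where
  "elementwise_continuous J f \<longleftrightarrow>
     (\<forall>j\<in>{1..J}. \<exists>g. continuous_on {node J (j - 1)..node J j} g \<and>
        (\<forall>\<rho>\<in>{node J (j - 1)<..<node J j}. f \<rho> = g \<rho>))"

lemma finite_nodes: "finite (nodes J)"
  by (simp add: nodes_def)

lemma node_mono: "i \<le> j \<Longrightarrow> node J i \<le> node J j"
  by (simp add: node_def divide_right_mono)

lemma node_strict_mono: "J > 0 \<Longrightarrow> i < j \<Longrightarrow> node J i < node J j"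
  by (simp add: node_def divide_strict_right_mono)

lemma node_0 [simp]: "node J 0 = 0"
  by (simp add: node_def)

lemma node_top: "J > 0 \<Longrightarrow> node J J = 1"
  by (simp add: node_def)

lemma element_subset:
  assumes "J > 0" "j \<in> {1..J}"
  shows "{node J (j - 1)..node J j} \<subseteq> {0..1}"
  using node_mono[of 0 "j - 1" J] node_mono[of j J J] node_top[of J] assms by auto

lemma off_nodes_in_element:
  assumes "J > 0" "\<rho> \<in> {0..1} - nodes J"
  obtains j where "j \<in> {1..J}" "\<rho> \<in> {node J (j - 1)<..<node J j}"
proof
  define k where "k = nat \<lfloor>\<rho> * real J\<rfloor>"
  have k: "real k \<le> \<rho> * real J" "\<rho> * real J < real k + 1"
    using assms by (auto simp: k_def)
  have "node J 0 \<in> nodes J" "node J J \<in> nodes J"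
    unfolding nodes_def by (intro imageI; simp)+
  then have "\<rho> \<noteq> 1"
    using assms node_top[of J] by auto
  then have "\<rho> * real J < real J"
    using assms by auto
  then have kJ: "k < J"
    using k by linarith
  then show "k + 1 \<in> {1..J}" by simp
  have "node J k \<in> nodes J"
    using kJ by (auto simp: nodes_def)
  then have "\<rho> \<noteq> node J k"
    using assms by auto
  then have "node J k < \<rho>"
    using k(1) assms(1) by (simp add: node_def field_simps)
  then show "\<rho> \<in> {node J (k + 1 - 1)<..<node J (k + 1)}"
    using k(2) assms(1) by (simp add: node_def field_simps)
qed

lemma elementwise_continuous_integrable:
  fixes f :: "real \<Rightarrow> real"
  assumes "J > 0" "elementwise_continuous J f"
  shows "f integrable_on {0..1}"
proof -
  have "k \<le> J \<Longrightarrow> f integrable_on {0..node J k}" for k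
  proof (induction k)
    case 0
    then show ?case
      using integrable_on_refl[of f 0] by simp
  next
    case (Suc k)
    then have "Suc k \<in> {1..J}" by simp
    from bspec[OF assms(2)[unfolded elementwise_continuous_def] this]
    obtain g where g: "continuous_on {node J k..node J (Suc k)} g"
        "\<forall>\<rho>\<in>{node J k<..<node J (Suc k)}. f \<rho> = g \<rho>"
      by auto
    have "f integrable_on cbox (node J k) (node J (Suc k))"
      by (rule integrable_spike_interior[of _ _ _ g])
        (use g in \<open>auto intro: integrable_continuous_interval\<close>)
    then show ?case
      using Suc node_mono[of 0 k J] node_mono[of k "Suc k" J]
      by (auto intro: Henstock_Kurzweil_Integration.integrable_combine)
  qed
  from this[of J] show ?thesis
    using node_top[OF assms(1)] by simp
qed

lemma elementwise_continuous_compose2: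
  assumes "elementwise_continuous J f" "elementwise_continuous J g"
    and "continuous_on UNIV (\<lambda>(u, v). h u v)"
  shows "elementwise_continuous J (\<lambda>\<rho>. h (f \<rho>) (g \<rho>))"
  unfolding elementwise_continuous_def
proof
  fix j assume j: "j \<in> {1..J}"
  obtain f' where f': "continuous_on {node J (j - 1)..node J j} f'"
      "\<forall>\<rho>\<in>{node J (j - 1)<..<node J j}. f \<rho> = f' \<rho>"
    using assms(1) j unfolding elementwise_continuous_def by blast
  obtain g' where g': "continuous_on {node J (j - 1)..node J j} g'"
      "\<forall>\<rho>\<in>{node J (j - 1)<..<node J j}. g \<rho> = g' \<rho>"
    using assms(2) j unfolding elementwise_continuous_def by blast
  have "continuous_on {node J (j - 1)..node J j} (\<lambda>\<rho>. h (f' \<rho>) (g' \<rho>))"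
    using continuous_on_compose2[OF assms(3) continuous_on_Pair[OF f'(1) g'(1)]] by simp
  then show "\<exists>g'. continuous_on {node J (j - 1)..node J j} g' \<and>
      (\<forall>\<rho>\<in>{node J (j - 1)<..<node J j}. h (f \<rho>) (g \<rho>) = g' \<rho>)"
    using f' g' by (intro exI[of _ "\<lambda>\<rho>. h (f' \<rho>) (g' \<rho>)"]) auto
qed

lemma elementwise_continuous_continuous:
  assumes "J > 0" "continuous_on {0..1} f"
  shows "elementwise_continuous J f"
  unfolding elementwise_continuous_def
  using continuous_on_subset[OF assms(2) element_subset[OF assms(1)]] by blast

lemma elementwise_continuous_const: "elementwise_continuous J (\<lambda>\<rho>. c)"
  unfolding elementwise_continuous_def by (auto intro!: exI[of _ "\<lambda>\<rho>. c"])

lemma elementwise_continuous_add: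
  "elementwise_continuous J f \<Longrightarrow> elementwise_continuous J g \<Longrightarrow>
    elementwise_continuous J (\<lambda>\<rho>. f \<rho> + g \<rho>)"
  by (rule elementwise_continuous_compose2)
    (auto simp: case_prod_unfold intro!: continuous_intros)

lemma elementwise_continuous_diff:
  "elementwise_continuous J f \<Longrightarrow> elementwise_continuous J g \<Longrightarrow>
    elementwise_continuous J (\<lambda>\<rho>. f \<rho> - g \<rho>)"
  by (rule elementwise_continuous_compose2)
    (auto simp: case_prod_unfold intro!: continuous_intros)

lemma elementwise_continuous_mult:
  fixes f g :: "real \<Rightarrow> real"
  shows "elementwise_continuous J f \<Longrightarrow> elementwise_continuous J g \<Longrightarrow>
    elementwise_continuous J (\<lambda>\<rho>. f \<rho> * g \<rho>)"
  by (rule elementwise_continuous_compose2)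
    (auto simp: case_prod_unfold intro!: continuous_intros)

lemma elementwise_continuous_scaleR:
  "elementwise_continuous J f \<Longrightarrow> elementwise_continuous J g \<Longrightarrow>
    elementwise_continuous J (\<lambda>\<rho>. f \<rho> *\<^sub>R g \<rho>)"
  by (rule elementwise_continuous_compose2)
    (auto simp: case_prod_unfold intro!: continuous_intros)

lemma elementwise_continuous_inner:
  "elementwise_continuous J f \<Longrightarrow> elementwise_continuous J g \<Longrightarrow>
    elementwise_continuous J (\<lambda>\<rho>. f \<rho> \<bullet> g \<rho>)"
  by (rule elementwise_continuous_compose2)
    (auto simp: case_prod_unfold intro!: continuous_intros)

lemma elementwise_continuous_nth:
  fixes f :: "real \<Rightarrow> real ^ 'n"
  assumes "elementwise_continuous J f"
  shows "elementwise_continuous J (\<lambda>\<rho>. f \<rho> $ i)"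
  by (rule elementwise_continuous_compose2[OF assms assms, of "\<lambda>u v. u $ i"])
    (auto simp: case_prod_unfold intro!: continuous_intros)

lemma elementwise_continuous_power:
  fixes f :: "real \<Rightarrow> real"
  assumes "elementwise_continuous J f"
  shows "elementwise_continuous J (\<lambda>\<rho>. f \<rho> ^ n)"
  by (rule elementwise_continuous_compose2[OF assms assms, of "\<lambda>u v. u ^ n"])
    (auto simp: case_prod_unfold intro!: continuous_intros)

lemma elementwise_continuous_perp:
  assumes "elementwise_continuous J f"
  shows "elementwise_continuous J (\<lambda>\<rho>. perp (f \<rho>))"
proof (rule elementwise_continuous_compose2[OF assms assms, of "\<lambda>u v. perp u"])
  have "perp u = (u $ 2) *\<^sub>R axis 1 1 - (u $ 1) *\<^sub>R axis 2 1" for u :: "real ^ 2"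
    by (simp add: perp_def vec_eq_iff forall_2 axis_def)
  then show "continuous_on UNIV (\<lambda>(u :: real ^ 2, v :: real ^ 2). perp u)"
    by (auto simp: case_prod_unfold intro!: continuous_intros)
qed

lemmas elementwise_continuous_intros =
  elementwise_continuous_const elementwise_continuous_add elementwise_continuous_diff
  elementwise_continuous_mult elementwise_continuous_scaleR elementwise_continuous_inner
  elementwise_continuous_nth elementwise_continuous_power elementwise_continuous_perp

lemma integral_cong_off_nodes:
  assumes "\<And>\<rho>. \<rho> \<in> {0..1} - nodes J \<Longrightarrow> f \<rho> = g \<rho>"
  shows "integral {0..1} f = integral {0..1} g"
  by (rule integral_spike[of "nodes J"])
    (use assms in \<open>auto simp: negligible_finite finite_nodes\<close>)

lemma integral_mono_off_nodes:
  fixes f g :: "real \<Rightarrow> real"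
  assumes "J > 0" "elementwise_continuous J f" "elementwise_continuous J g"
    and "\<And>\<rho>. \<rho> \<in> {0..1} - nodes J \<Longrightarrow> f \<rho> \<le> g \<rho>"
  shows "integral {0..1} f \<le> integral {0..1} g"
proof -
  define f' where "f' \<rho> = (if \<rho> \<in> nodes J then g \<rho> else f \<rho>)" for \<rho>
  have "f' integrable_on {0..1}"
    by (rule integrable_spike_finite[OF finite_nodes, of _ _ _ f])
      (use elementwise_continuous_integrable[OF assms(1,2)] in \<open>auto simp: f'_def\<close>)
  then have "integral {0..1} f' \<le> integral {0..1} g"
    by (rule integral_le)
      (use assms elementwise_continuous_integrable[OF assms(1,3)] in \<open>auto simp: f'_def\<close>)
  moreover have "integral {0..1} f = integral {0..1} f'"
    by (rule integral_cong_off_nodes) (auto simp: f'_def)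
  ultimately show ?thesis by simp
qed

text \<open>By continuity of its representative, \<open>f\<close> has a positive integral over the first element; the other
  elements cannot decrease it.\<close>

lemma integral_pos_off_nodes:
  fixes f :: "real \<Rightarrow> real"
  assumes J: "J > 0" and f: "elementwise_continuous J f"
    and pos: "\<And>j \<rho>. j \<in> {1..J} \<Longrightarrow> \<rho> \<in> {node J (j - 1)<..<node J j} \<Longrightarrow> f \<rho> > 0"
  shows "integral {0..1} f > 0"
proof -
  obtain g where g: "continuous_on {0..node J 1} g" "\<forall>\<rho>\<in>{0<..<node J 1}. f \<rho> = g \<rho>"
  proof -
    have "1 \<in> {1..J}" using J by simp
    from bspec[OF f[unfolded elementwise_continuous_def] this] show thesis
      using that by auto
  qed
  define f' where "f' \<rho> = (if \<rho> \<in> nodes J then 0 else f \<rho>)" for \<rho>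
  have int: "f' integrable_on {0..1}"
    by (rule integrable_spike_finite[OF finite_nodes, of _ _ _ f])
      (use elementwise_continuous_integrable[OF J f] in \<open>auto simp: f'_def\<close>)
  have le1: "node J 1 \<le> 1"
    using J by (simp add: node_def)
  have "integral {0..node J 1} (\<lambda>_. 0) < integral {0..node J 1} g"
  proof (rule integral_less_real)
    show "{0<..<node J 1} \<noteq> {}"
      using node_strict_mono[OF J, of 0 1] by simp
    show "0 < g \<rho>" if "\<rho> \<in> {0<..<node J 1}" for \<rho>
      using pos[of 1 \<rho>] g(2) that J by simp
  qed (use g(1) in simp_all)
  also have "integral {0..node J 1} g = integral {0..node J 1} f'"
  proof (rule integral_spike[OF negligible_finite[OF finite_nodes]])
    fix \<rho> assume \<rho>: "\<rho> \<in> {0..node J 1} - nodes J"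
    have "node J 0 \<in> nodes J" "node J 1 \<in> nodes J"
      unfolding nodes_def using J by (intro imageI; simp)+
    then have "\<rho> \<noteq> 0" "\<rho> \<noteq> node J 1"
      using \<rho> by auto
    then show "f' \<rho> = g \<rho>"
      using \<rho> g(2) by (auto simp: f'_def)
  qed
  also have "\<dots> \<le> integral {0..1} f'"
  proof (rule integral_subset_le)
    show "f' integrable_on {0..node J 1}"
      using integrable_subinterval_real[OF int] le1 by auto
    show "\<forall>\<rho>\<in>{0..1}. 0 \<le> f' \<rho>"
    proof
      fix \<rho> :: real assume "\<rho> \<in> {0..1}"
      show "0 \<le> f' \<rho>"
      proof (cases "\<rho> \<in> nodes J")
        case False
        then obtain j where "j \<in> {1..J}" "\<rho> \<in> {node J (j - 1)<..<node J j}"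
          using off_nodes_in_element[OF J] \<open>\<rho> \<in> {0..1}\<close> by blast
        then show ?thesis
          using pos False by (simp add: f'_def less_imp_le)
      qed (simp add: f'_def)
    qed
  qed (use int le1 in auto)
  also have "\<dots> = integral {0..1} f"
    by (rule integral_cong_off_nodes) (auto simp: f'_def)
  finally show ?thesis by simp
qed

section \<open>Finite element functions and their derivatives\<close>

lemma fe_space_continuous: "f \<in> fe_space \<Omega> J \<Longrightarrow> continuous_on {0..1} f"
  by (simp add: fe_space_def)

lemma fe_space_affine:
  assumes "f \<in> fe_space \<Omega> J" "j \<in> {1..J}"
  shows "\<exists>a b. \<forall>\<rho>\<in>{node J (j - 1)..node J j}. f \<rho> = a + b * \<rho>"
proof -
  have "affine_fun_on {node J (j - 1)..node J j} f"
    using assms unfolding fe_space_def by blast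
  then show ?thesis unfolding affine_fun_on_def .
qed

lemma fe_space_const: "(\<lambda>\<rho>. c) \<in> fe_space \<Omega> J"
proof -
  have "affine_fun_on S (\<lambda>\<rho>. c)" for S
    unfolding affine_fun_on_def by (rule exI[of _ c], rule exI[of _ 0]) simp
  then show ?thesis by (simp add: fe_space_def)
qed

lemma fe_space_add:
  assumes "f \<in> fe_space \<Omega> J" "g \<in> fe_space \<Omega> J"
  shows "(\<lambda>\<rho>. f \<rho> + g \<rho>) \<in> fe_space \<Omega> J"
proof -
  have "affine_fun_on {node J (j - 1)..node J j} (\<lambda>\<rho>. f \<rho> + g \<rho>)"
    if j: "j \<in> {1..J}" for j
  proof -
    obtain a b where f: "\<forall>\<rho>\<in>{node J (j - 1)..node J j}. f \<rho> = a + b * \<rho>"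
      using fe_space_affine[OF assms(1) j] by blast
    obtain c d where g: "\<forall>\<rho>\<in>{node J (j - 1)..node J j}. g \<rho> = c + d * \<rho>"
      using fe_space_affine[OF assms(2) j] by blast
    show ?thesis
      unfolding affine_fun_on_def
      by (rule exI[of _ "a + c"], rule exI[of _ "b + d"])
        (use f g in \<open>auto simp: algebra_simps\<close>)
  qed
  then show ?thesis
    using assms by (simp add: fe_space_def continuous_on_add)
qed

lemma fe_space2_add:
  "f \<in> fe_space2 \<Omega> J \<Longrightarrow> g \<in> fe_space2 \<Omega> J \<Longrightarrow> (\<lambda>\<rho>. f \<rho> + g \<rho>) \<in> fe_space2 \<Omega> J"
  by (auto simp: fe_space2_def intro: fe_space_add)

lemma fe_space2_continuous:
  assumes "f \<in> fe_space2 \<Omega> J"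
  shows "continuous_on {0..1} f"
proof -
  have "continuous_on {0..1} (\<lambda>\<rho>. \<chi> i. f \<rho> $ i)"
    using assms unfolding fe_space2_def
    by (intro continuous_on_vec_lambda fe_space_continuous[of _ \<Omega> J]) blast
  then show ?thesis by simp
qed

lemma fe_space2_element_derivative:
  assumes "X \<in> fe_space2 \<Omega> J" "j \<in> {1..J}"
  obtains B where
    "\<And>\<rho>. \<rho> \<in> {node J (j - 1)<..<node J j} \<Longrightarrow> (X has_vector_derivative B) (at \<rho>)"
    "\<And>\<rho>. \<rho> \<in> {node J (j - 1)<..<node J j} \<Longrightarrow> drho X \<rho> = B"
proof -
  have "\<forall>i. \<exists>a b. \<forall>\<rho>\<in>{node J (j - 1)..node J j}. X \<rho> $ i = a + b * \<rho>"
    using assms(1) unfolding fe_space2_def by (intro allI fe_space_affine[OF _ assms(2)]) blast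
  then obtain a b where ab: "\<And>i. \<forall>\<rho>\<in>{node J (j - 1)..node J j}. X \<rho> $ i = a i + b i * \<rho>"
    by metis
  define A where "A = (\<chi> i. a i)"
  define B where "B = (\<chi> i. b i)"
  have X: "A + \<rho> *\<^sub>R B = X \<rho>" if "\<rho> \<in> {node J (j - 1)<..<node J j}" for \<rho>
    using ab that by (simp add: vec_eq_iff A_def B_def)
  have "((\<lambda>\<rho>. A + \<rho> *\<^sub>R B) has_vector_derivative B) (at \<rho>)" for \<rho>
    by (auto intro!: derivative_eq_intros)
  then have "(X has_vector_derivative B) (at \<rho>)" if "\<rho> \<in> {node J (j - 1)<..<node J j}" for \<rho>
    by (rule has_vector_derivative_transform_within_open[OF _ open_greaterThanLessThan that X])
  then show thesis
    using that vector_derivative_at by blast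
qed

lemma fe_space2_has_derivative:
  assumes "J > 0" "X \<in> fe_space2 \<Omega> J" "\<rho> \<in> {0..1} - nodes J"
  shows "(X has_vector_derivative drho X \<rho>) (at \<rho>)"
  by (metis assms off_nodes_in_element fe_space2_element_derivative)

text \<open>The derivative is constant on each element, so every function of it is allowed, continuous
  or not; this covers the reciprocal of the speed.\<close>

lemma elementwise_continuous_drho:
  assumes "X \<in> fe_space2 \<Omega> J"
  shows "elementwise_continuous J (\<lambda>\<rho>. h (drho X \<rho>))"
  unfolding elementwise_continuous_def
proof
  fix j assume "j \<in> {1..J}"
  then obtain B where "\<And>\<rho>. \<rho> \<in> {node J (j - 1)<..<node J j} \<Longrightarrow> drho X \<rho> = B"
    using fe_space2_element_derivative[OF assms] by metis
  then show "\<exists>g. continuous_on {node J (j - 1)..node J j} g \<and>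
      (\<forall>\<rho>\<in>{node J (j - 1)<..<node J j}. h (drho X \<rho>) = g \<rho>)"
    by (intro exI[of _ "\<lambda>\<rho>. h B"]) auto
qed

section \<open>Pointwise estimates and identities\<close>

lemma inner_diff_ge:
  fixes u v :: "'a::real_inner"
  shows "norm u * (norm v - norm u) \<le> v \<bullet> (v - u)"
proof -
  have "v \<bullet> u \<le> norm v * norm u"
    by (rule norm_cauchy_schwarz)
  moreover have "0 \<le> (norm v - norm u)\<^sup>2" by simp
  ultimately show ?thesis
    by (simp add: inner_diff_right power2_eq_square algebra_simps flip: power2_norm_eq_inner)
qed

text \<open>The old radius \<open>x\<close> multiplies the gradient term and the new speed \<open>|v|\<close> multiplies the radius
  increment: with this pairing the products telescope to \<open>y |v| - x |u|\<close>.\<close>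

lemma area_increment_le:
  fixes u v :: "'a::real_inner"
  assumes "x \<ge> 0" "norm u > 0"
  shows "y * norm v - x * norm u \<le>
    (y - x) * norm v + (x *\<^sub>R v) \<bullet> (inverse (norm u) *\<^sub>R (v - u))"
proof -
  have "norm v - norm u \<le> inverse (norm u) * (v \<bullet> (v - u))"
    using inner_diff_ge[of u v] assms by (simp add: field_simps)
  then have "x * (norm v - norm u) \<le> x * (inverse (norm u) * (v \<bullet> (v - u)))"
    using assms(1) by (rule mult_left_mono)
  then show ?thesis
    by (simp add: algebra_simps)
qed

lemma avg_normal_inner:
  "d \<bullet> avg_normal X Y \<rho> =
    - (d $ 1 * (2 * X \<rho> $ 1 * drho X \<rho> $ 2 + 2 * Y \<rho> $ 1 * drho Y \<rho> $ 2
              + X \<rho> $ 1 * drho Y \<rho> $ 2 + Y \<rho> $ 1 * drho X \<rho> $ 2)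
      - d $ 2 * (2 * X \<rho> $ 1 * drho X \<rho> $ 1 + 2 * Y \<rho> $ 1 * drho Y \<rho> $ 1
              + X \<rho> $ 1 * drho Y \<rho> $ 1 + Y \<rho> $ 1 * drho X \<rho> $ 1)) / 6"
  by (simp add: avg_normal_def perp_def inner_vec_def sum_2) (simp add: algebra_simps)

text \<open>In the primitive, \<open>(x\<^sup>2 + x y + y\<^sup>2) / 3\<close> is the mean of the squared radius along the segment
  from \<open>X\<close> to \<open>Y\<close>.\<close>

lemma volume_increment:
  fixes X Y :: "real \<Rightarrow> real ^ 2"
  assumes X: "(X has_vector_derivative drho X \<rho>) (at \<rho>)"
    and Y: "(Y has_vector_derivative drho Y \<rho>) (at \<rho>)"
  shows "((\<lambda>\<rho>. ((X \<rho> $ 1)\<^sup>2 + X \<rho> $ 1 * Y \<rho> $ 1 + (Y \<rho> $ 1)\<^sup>2) / 3 * (Y \<rho> $ 2 - X \<rho> $ 2))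
    has_vector_derivative
      (Y \<rho> $ 1)\<^sup>2 * drho Y \<rho> $ 2 - (X \<rho> $ 1)\<^sup>2 * drho X \<rho> $ 2
        + 2 * ((Y \<rho> - X \<rho>) \<bullet> avg_normal X Y \<rho>)) (at \<rho>)"
proof -
  have comp [derivative_intros]: "((\<lambda>\<rho>. Z \<rho> $ i) has_field_derivative drho Z \<rho> $ i) (at \<rho>)"
    if "(Z has_vector_derivative drho Z \<rho>) (at \<rho>)" for Z :: "real \<Rightarrow> real ^ 2" and i
    using bounded_linear.has_vector_derivative[OF bounded_linear_vec_nth that]
    by (simp add: has_real_derivative_iff_has_vector_derivative)
  show ?thesis
    unfolding has_real_derivative_iff_has_vector_derivative[symmetric] avg_normal_inner
    by (rule derivative_eq_intros comp X Y refl | simp)+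
      (simp add: power2_eq_square field_simps)
qed

text \<open>The left-hand side is the minimum over \<open>c\<close> of the integral of \<open>w (k - c)\<^sup>2\<close>.\<close>

lemma weighted_variance_nonneg:
  fixes w k :: "real \<Rightarrow> real"
  assumes J: "J > 0" and w: "elementwise_continuous J w" and k: "elementwise_continuous J k"
    and nonneg: "\<And>\<rho>. \<rho> \<in> {0..1} - nodes J \<Longrightarrow> w \<rho> \<ge> 0"
  shows "integral {0..1} (\<lambda>\<rho>. w \<rho> * (k \<rho>)\<^sup>2)
    - (integral {0..1} (\<lambda>\<rho>. w \<rho> * k \<rho>))\<^sup>2 / integral {0..1} w \<ge> 0"
proof -
  let ?A = "integral {0..1} (\<lambda>\<rho>. w \<rho> * (k \<rho>)\<^sup>2)"
  let ?B = "integral {0..1} (\<lambda>\<rho>. w \<rho> * k \<rho>)"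
  let ?C = "integral {0..1} w"
  define c where "c = ?B / ?C"
  have "0 \<le> integral {0..1} (\<lambda>\<rho>. w \<rho> * (k \<rho> - c)\<^sup>2)"
    using integral_mono_off_nodes[OF J, of "\<lambda>\<rho>. 0" "\<lambda>\<rho>. w \<rho> * (k \<rho> - c)\<^sup>2"] w k nonneg
    by (simp add: elementwise_continuous_intros)
  also have "(\<lambda>\<rho>. w \<rho> * (k \<rho> - c)\<^sup>2) =
      (\<lambda>\<rho>. w \<rho> * (k \<rho>)\<^sup>2 - (2 * c) * (w \<rho> * k \<rho>) + c\<^sup>2 * w \<rho>)"
    by (simp add: fun_eq_iff power2_eq_square algebra_simps)
  also have "integral {0..1} \<dots> = ?A - 2 * c * ?B + c\<^sup>2 * ?C"
    using w k
    by (simp add: integral_add integral_diff elementwise_continuous_integrable[OF J]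
        elementwise_continuous_intros)
  also have "\<dots> = ?A - ?B\<^sup>2 / ?C"
    by (simp add: c_def power2_eq_square field_simps)
  finally show ?thesis .
qed

section \<open>Stability and volume conservation\<close>

lemma admissible_curve_weight_pos:
  assumes part: "bdry_partition \<Omega> dD d0 d1 d2" and J: "J > 0" and X: "admissible_curve J d0 X"
    and j: "j \<in> {1..J}" "\<rho> \<in> {node J (j - 1)<..<node J j}"
  shows "X \<rho> $ 1 > 0" "norm (drho X \<rho>) > 0"
proof -
  have "d0 \<subseteq> {0, 1}"
    using part by (cases \<Omega>) (auto simp: bdry_partition_def)
  moreover have "0 < \<rho>" "\<rho> < 1"
    using element_subset[OF J j(1)] j(2) by auto
  ultimately show "X \<rho> $ 1 > 0"
    using X by (auto simp: admissible_curve_def)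
  show "norm (drho X \<rho>) > 0"
    using X j unfolding admissible_curve_def by blast
qed

lemma enclosed_volume_eq:
  "enclosed_volume d1 X = - (pi * integral {0..1} (\<lambda>\<rho>. (X \<rho> $ 1)\<^sup>2 * drho X \<rho> $ 2))
     + pi * (\<Sum>p\<in>d1. (-1) ^ (nat \<lfloor>p\<rfloor> + 1) * (X p $ 1)\<^sup>2 * (X p $ 2))"
proof -
  have "((X \<rho> $ 1)\<^sup>2 *\<^sub>R unit_normal X \<rho>) \<bullet> (norm (drho X \<rho>) *\<^sub>R axis 1 1) =
      - ((X \<rho> $ 1)\<^sup>2 * drho X \<rho> $ 2)" for \<rho>
    by (cases "drho X \<rho> = 0") (simp_all add: unit_normal_def perp_def inner_axis)
  then show ?thesis
    by (simp add: enclosed_volume_def l2_inner_def)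
qed

text \<open>The factor \<open>(-1) ^ (p + 1)\<close> is the outward direction at the boundary point \<open>p\<close>, so the sum over
  \<open>d1\<close> is a difference of boundary values once the other boundary points contribute 0.\<close>

lemma volume_boundary_terms:
  assumes part: "bdry_partition \<Omega> dD d0 d1 d2"
    and X: "X \<in> fe_space_d0 \<Omega> J d0"
    and D: "(\<lambda>\<rho>. Y \<rho> - X \<rho>) \<in> fe_space_d \<Omega> J dD d0 d1 d2"
    and P: "\<And>\<rho>. P \<rho> = ((X \<rho> $ 1)\<^sup>2 + X \<rho> $ 1 * Y \<rho> $ 1 + (Y \<rho> $ 1)\<^sup>2) / 3 * (Y \<rho> $ 2 - X \<rho> $ 2)"
  shows "P 1 - P 0 = (\<Sum>p\<in>d1. (-1) ^ (nat \<lfloor>p\<rfloor> + 1) * (Y p $ 1)\<^sup>2 * (Y p $ 2))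
      - (\<Sum>p\<in>d1. (-1) ^ (nat \<lfloor>p\<rfloor> + 1) * (X p $ 1)\<^sup>2 * (X p $ 2))"
proof (cases \<Omega>)
  case Circle
  have "X 0 $ i = X 1 $ i" "Y 0 $ i - X 0 $ i = Y 1 $ i - X 1 $ i" for i
    using X D Circle
    by (auto simp: fe_space_d_def fe_space_d0_def fe_space2_def fe_space_def)
  then have "X 0 = X 1" "Y 0 = Y 1"
    by (simp_all add: vec_eq_iff)
  moreover have "d1 = {}"
    using part Circle by (simp add: bdry_partition_def)
  ultimately show ?thesis by (simp add: P)
next
  case Unit_Interval
  have bd: "{0, 1} = dD \<union> d0 \<union> d1 \<union> d2"
    using part Unit_Interval by (simp add: bdry_partition_def)
  have eq1: "Y p $ 1 = X p $ 1" if "p \<in> d1" for p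
    using D that by (auto simp: fe_space_d_def)
  have P1: "P p = (X p $ 1)\<^sup>2 * (Y p $ 2 - X p $ 2)" if "p \<in> d1" for p
    by (simp add: P eq1[OF that] power2_eq_square)
  have P0: "P p = 0" if p: "p \<in> {0, 1} - d1" for p
  proof -
    have "p \<in> dD \<union> d0 \<union> d1 \<union> d2"
      using p unfolding bd[symmetric] by simp
    then consider "p \<in> dD" | "p \<in> d0" | "p \<in> d2"
      using p by blast
    then show ?thesis
    proof cases
      case 1
      then have "Y p - X p = 0" using D by (auto simp: fe_space_d_def)
      then show ?thesis by (simp add: P)
    next
      case 2
      then have "X p $ 1 = 0" "Y p $ 1 - X p $ 1 = 0"
        using X D by (auto simp: fe_space_d_def fe_space_d0_def)
      then show ?thesis by (simp add: P)
    next
      case 3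
      then have "Y p $ 2 - X p $ 2 = 0" using D by (auto simp: fe_space_d_def)
      then show ?thesis by (simp add: P)
    qed
  qed
  have sub: "d1 \<subseteq> {0, 1}" unfolding bd by blast
  have "(\<Sum>p\<in>d1. (-1) ^ (nat \<lfloor>p\<rfloor> + 1) * (Y p $ 1)\<^sup>2 * (Y p $ 2))
      - (\<Sum>p\<in>d1. (-1) ^ (nat \<lfloor>p\<rfloor> + 1) * (X p $ 1)\<^sup>2 * (X p $ 2))
      = (\<Sum>p\<in>d1. (-1) ^ (nat \<lfloor>p\<rfloor> + 1) * P p)"
    unfolding sum_subtractf[symmetric]
    by (rule sum.cong) (simp_all add: P1 eq1 algebra_simps)
  also have "\<dots> = (\<Sum>p\<in>{0, 1}. (-1) ^ (nat \<lfloor>p\<rfloor> + 1) * P p)"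
    by (rule sum.mono_neutral_left) (use sub P0 in auto)
  also have "\<dots> = P 1 - P 0" by simp
  finally show ?thesis by simp
qed

theorem theorem3p5:
  fixes \<Omega> :: curve_domain and J :: nat and dD d0 d1 d2 :: "real set"
    and dt :: real and X Y :: "real \<Rightarrow> real ^ 2" and \<kappa> :: "real \<Rightarrow> real"
  assumes "bdry_partition \<Omega> dD d0 d1 d2"
    and "J \<ge> 3"
    and "dt > 0"
    and "X \<in> fe_space_d0 \<Omega> J d0"
    and "(\<lambda>\<rho>. Y \<rho> - X \<rho>) \<in> fe_space_d \<Omega> J dD d0 d1 d2"
    and "\<kappa> \<in> fe_space \<Omega> J"
    and "admissible_curve J d0 X"
    and "admissible_curve J d0 Y"
    and "\<And>\<zeta>. \<zeta> \<in> fe_space \<Omega> J \<Longrightarrow>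
           1 / dt * l2_inner (\<lambda>\<rho>. Y \<rho> - X \<rho>) (\<lambda>\<rho>. \<zeta> \<rho> *\<^sub>R avg_normal X Y \<rho>)
           - l2_inner (\<lambda>\<rho>. X \<rho> $ 1 * \<kappa> \<rho>) (\<lambda>\<rho>. \<zeta> \<rho> * norm (drho X \<rho>))
           + l2_inner (\<lambda>\<rho>. X \<rho> $ 1) (\<lambda>\<rho>. \<kappa> \<rho> * norm (drho X \<rho>))
             / l2_inner (\<lambda>\<rho>. X \<rho> $ 1) (\<lambda>\<rho>. norm (drho X \<rho>))
             * l2_inner (\<lambda>\<rho>. X \<rho> $ 1) (\<lambda>\<rho>. \<zeta> \<rho> * norm (drho X \<rho>)) = 0"
    and "\<And>\<eta>. \<eta> \<in> fe_space_d \<Omega> J dD d0 d1 d2 \<Longrightarrow>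
           l2_inner (\<lambda>\<rho>. \<kappa> \<rho> *\<^sub>R avg_normal X Y \<rho>) \<eta>
           + l2_inner (\<lambda>\<rho>. \<eta> \<rho> $ 1) (\<lambda>\<rho>. norm (drho Y \<rho>))
           + l2_inner (\<lambda>\<rho>. (X \<rho> $ 1) *\<^sub>R drho Y \<rho>)
               (\<lambda>\<rho>. inverse (norm (drho X \<rho>)) *\<^sub>R drho \<eta> \<rho>) = 0"
  shows "1 / (2 * pi) * surface_area X - 1 / (2 * pi) * surface_area Y
           \<ge> dt * l2_inner (\<lambda>\<rho>. X \<rho> $ 1 * \<bar>\<kappa> \<rho>\<bar>^2) (\<lambda>\<rho>. norm (drho X \<rho>))
             - dt * ((l2_inner (\<lambda>\<rho>. X \<rho> $ 1) (\<lambda>\<rho>. \<kappa> \<rho> * norm (drho X \<rho>)))^2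
                     / l2_inner (\<lambda>\<rho>. X \<rho> $ 1) (\<lambda>\<rho>. norm (drho X \<rho>)))
         \<and> dt * l2_inner (\<lambda>\<rho>. X \<rho> $ 1 * \<bar>\<kappa> \<rho>\<bar>^2) (\<lambda>\<rho>. norm (drho X \<rho>))
             - dt * ((l2_inner (\<lambda>\<rho>. X \<rho> $ 1) (\<lambda>\<rho>. \<kappa> \<rho> * norm (drho X \<rho>)))^2
                     / l2_inner (\<lambda>\<rho>. X \<rho> $ 1) (\<lambda>\<rho>. norm (drho X \<rho>))) \<ge> 0
         \<and> enclosed_volume d1 Y = enclosed_volume d1 X"
proof -
  note part = assms(1) and scheme1 = assms(9) and scheme2 = assms(10)
  have J: "J > 0" using assms(2) by simp
  let ?D = "\<lambda>\<rho>. Y \<rho> - X \<rho>"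
  have X: "X \<in> fe_space2 \<Omega> J" and D: "?D \<in> fe_space2 \<Omega> J"
    using assms(4,5) by (auto simp: fe_space_d_def fe_space_d0_def)
  have Y: "Y \<in> fe_space2 \<Omega> J"
    using fe_space2_add[OF X D] by simp
  have drho_D: "drho ?D \<rho> = drho Y \<rho> - drho X \<rho>" if "\<rho> \<in> {0..1} - nodes J" for \<rho>
    using fe_space2_has_derivative[OF J X that] fe_space2_has_derivative[OF J Y that]
    by (intro vector_derivative_at has_vector_derivative_diff)
  have pos: "X \<rho> $ 1 > 0" "norm (drho X \<rho>) > 0" if "\<rho> \<in> {0..1} - nodes J" for \<rho>
    using off_nodes_in_element[OF J that] admissible_curve_weight_pos[OF part J assms(7)]
    by metis+
  have ec [simp]: "elementwise_continuous J X" "elementwise_continuous J Y"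
      "elementwise_continuous J \<kappa>"
    using fe_space2_continuous[OF X] fe_space2_continuous[OF Y] fe_space_continuous[OF assms(6)]
    by (auto intro: elementwise_continuous_continuous[OF J])
  have ecd [simp]: "elementwise_continuous J (\<lambda>\<rho>. drho X \<rho>)" "elementwise_continuous J (\<lambda>\<rho>. drho Y \<rho>)"
      "elementwise_continuous J (\<lambda>\<rho>. drho ?D \<rho>)"
      "elementwise_continuous J (\<lambda>\<rho>. norm (drho X \<rho>))"
      "elementwise_continuous J (\<lambda>\<rho>. norm (drho Y \<rho>))"
      "elementwise_continuous J (\<lambda>\<rho>. inverse (norm (drho X \<rho>)))"
    using elementwise_continuous_drho[OF X, of "\<lambda>u. u"] elementwise_continuous_drho[OF Y, of "\<lambda>u. u"]
      elementwise_continuous_drho[OF D, of "\<lambda>u. u"] elementwise_continuous_drho[OF X, of norm]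
      elementwise_continuous_drho[OF Y, of norm]
      elementwise_continuous_drho[OF X, of "\<lambda>u. inverse (norm u)"]
    by auto
  have ec_normal [simp]: "elementwise_continuous J (\<lambda>\<rho>. avg_normal X Y \<rho>)"
    unfolding avg_normal_def by (intro elementwise_continuous_intros ec ecd)
  note int = elementwise_continuous_integrable[OF J]

  let ?w = "\<lambda>\<rho>. X \<rho> $ 1 * norm (drho X \<rho>)"
  define K where "K = integral {0..1} (\<lambda>\<rho>. ?w \<rho> * (\<kappa> \<rho>)\<^sup>2)"
  define B where "B = integral {0..1} (\<lambda>\<rho>. ?w \<rho> * \<kappa> \<rho>)"
  define C where "C = integral {0..1} ?w"
  have K: "l2_inner (\<lambda>\<rho>. X \<rho> $ 1 * \<bar>\<kappa> \<rho>\<bar>\<^sup>2) (\<lambda>\<rho>. norm (drho X \<rho>)) = K"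
      "l2_inner (\<lambda>\<rho>. X \<rho> $ 1 * \<kappa> \<rho>) (\<lambda>\<rho>. \<kappa> \<rho> * norm (drho X \<rho>)) = K"
    by (simp_all add: l2_inner_def K_def power2_eq_square mult_ac)
  have B: "l2_inner (\<lambda>\<rho>. X \<rho> $ 1) (\<lambda>\<rho>. \<kappa> \<rho> * norm (drho X \<rho>)) = B"
      "l2_inner (\<lambda>\<rho>. X \<rho> $ 1 * \<kappa> \<rho>) (\<lambda>\<rho>. norm (drho X \<rho>)) = B"
    by (simp_all add: l2_inner_def B_def mult_ac)
  have C: "l2_inner (\<lambda>\<rho>. X \<rho> $ 1) (\<lambda>\<rho>. norm (drho X \<rho>)) = C"
    by (simp add: l2_inner_def C_def)
  have "C > 0"
    unfolding C_def
    by (rule integral_pos_off_nodes[OF J])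
      (use admissible_curve_weight_pos[OF part J assms(7)] in
        \<open>auto simp: elementwise_continuous_intros\<close>)

  have dissipation_nonneg: "0 \<le> K - B\<^sup>2 / C"
    unfolding K_def B_def C_def
    by (rule weighted_variance_nonneg[OF J])
      (use pos in \<open>auto simp: elementwise_continuous_intros less_imp_le\<close>)

  have stability: "dt * K - dt * (B\<^sup>2 / C) \<le>
      1 / (2 * pi) * surface_area X - 1 / (2 * pi) * surface_area Y"
  proof -
    let ?q = "\<lambda>\<rho>. ?D \<rho> $ 1 * norm (drho Y \<rho>)"
    let ?r = "\<lambda>\<rho>. ((X \<rho> $ 1) *\<^sub>R drho Y \<rho>) \<bullet> (inverse (norm (drho X \<rho>)) *\<^sub>R drho ?D \<rho>)"
    define p where "p = integral {0..1} (\<lambda>\<rho>. \<kappa> \<rho> * (?D \<rho> \<bullet> avg_normal X Y \<rho>))"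
    have "1 / dt * p - K + B / C * B = 0"
      using scheme1[OF assms(6)] unfolding K B C by (simp add: l2_inner_def p_def)
    then have p: "p = dt * K - dt * (B\<^sup>2 / C)"
      using assms(3) by (simp add: field_simps power2_eq_square)
    have "p + integral {0..1} ?q + integral {0..1} ?r = 0"
      using scheme2[OF assms(5)] by (simp add: l2_inner_def p_def inner_commute)
    moreover have "integral {0..1} (\<lambda>\<rho>. Y \<rho> $ 1 * norm (drho Y \<rho>) - ?w \<rho>)
        \<le> integral {0..1} (\<lambda>\<rho>. ?q \<rho> + ?r \<rho>)"
    proof (rule integral_mono_off_nodes[OF J])
      fix \<rho> assume \<rho>: "\<rho> \<in> {0..1} - nodes J"
      show "Y \<rho> $ 1 * norm (drho Y \<rho>) - ?w \<rho> \<le> ?q \<rho> + ?r \<rho>"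
        using area_increment_le[of "X \<rho> $ 1" "drho X \<rho>" "Y \<rho> $ 1" "drho Y \<rho>"] pos[OF \<rho>]
        by (simp add: drho_D[OF \<rho>] less_imp_le)
    qed (intro elementwise_continuous_intros ec ecd)+
    moreover have "integral {0..1} (\<lambda>\<rho>. ?q \<rho> + ?r \<rho>) = integral {0..1} ?q + integral {0..1} ?r"
      by (intro integral_add int elementwise_continuous_intros ec ecd)
    moreover have "integral {0..1} (\<lambda>\<rho>. Y \<rho> $ 1 * norm (drho Y \<rho>) - ?w \<rho>) =
        integral {0..1} (\<lambda>\<rho>. Y \<rho> $ 1 * norm (drho Y \<rho>)) - C"
      unfolding C_def by (intro integral_diff int elementwise_continuous_intros ec ecd)
    ultimately show ?thesis
      using p by (simp add: surface_area_def C_def)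
  qed

  have volume: "enclosed_volume d1 Y = enclosed_volume d1 X"
  proof -
    let ?v = "\<lambda>Z \<rho>. (Z \<rho> $ 1)\<^sup>2 * drho Z \<rho> $ 2"
    let ?f = "\<lambda>\<rho>. ?D \<rho> \<bullet> avg_normal X Y \<rho>"
    define P where
      "P \<rho> = ((X \<rho> $ 1)\<^sup>2 + X \<rho> $ 1 * Y \<rho> $ 1 + (Y \<rho> $ 1)\<^sup>2) / 3 * (Y \<rho> $ 2 - X \<rho> $ 2)" for \<rho>
    \<comment> \<open>For the constant test function the quotient multiplies its own denominator \<open>C\<close>; as \<open>C\<close> is not 0,
      its term becomes \<open>B\<close> and cancels the curvature term before it.\<close>
    have orth: "integral {0..1} ?f = 0"
      using scheme1[OF fe_space_const[of 1]] \<open>C > 0\<close> assms(3) unfolding mult_1_left K B C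
      by (simp add: l2_inner_def)
    have "continuous_on {0..1} P"
      unfolding P_def using fe_space2_continuous[OF X] fe_space2_continuous[OF Y]
      by (intro continuous_intros) auto
    then have "((\<lambda>\<rho>. ?v Y \<rho> - ?v X \<rho> + 2 * ?f \<rho>) has_integral (P 1 - P 0)) {0..1}"
      unfolding P_def
      by (intro fundamental_theorem_of_calculus_interior_strong[OF finite_nodes[of J]]
          volume_increment fe_space2_has_derivative[OF J X] fe_space2_has_derivative[OF J Y]) auto
    then have "integral {0..1} (\<lambda>\<rho>. ?v Y \<rho> - ?v X \<rho> + 2 * ?f \<rho>) = P 1 - P 0"
      by (rule integral_unique)
    moreover have "integral {0..1} (\<lambda>\<rho>. ?v Y \<rho> - ?v X \<rho> + 2 * ?f \<rho>) =
        integral {0..1} (\<lambda>\<rho>. ?v Y \<rho> - ?v X \<rho>) + integral {0..1} (\<lambda>\<rho>. 2 * ?f \<rho>)"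
      by (intro integral_add int elementwise_continuous_intros ec ecd ec_normal)
    moreover have "integral {0..1} (\<lambda>\<rho>. ?v Y \<rho> - ?v X \<rho>) =
        integral {0..1} (?v Y) - integral {0..1} (?v X)"
      by (intro integral_diff int elementwise_continuous_intros ec ecd)
    moreover have "P 1 - P 0 = (\<Sum>p\<in>d1. (-1) ^ (nat \<lfloor>p\<rfloor> + 1) * (Y p $ 1)\<^sup>2 * (Y p $ 2))
      - (\<Sum>p\<in>d1. (-1) ^ (nat \<lfloor>p\<rfloor> + 1) * (X p $ 1)\<^sup>2 * (X p $ 2))" (is "_ = ?sY - ?sX")
      by (rule volume_boundary_terms[OF part assms(4,5) P_def])
    ultimately have "integral {0..1} (?v Y) - integral {0..1} (?v X) = ?sY - ?sX"
      using orth by simp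
    then have "pi * (integral {0..1} (?v Y) - integral {0..1} (?v X)) = pi * (?sY - ?sX)"
      by (rule arg_cong)
    then show ?thesis
      unfolding enclosed_volume_eq by (simp add: algebra_simps)
  qed

  have "0 \<le> dt * (K - B\<^sup>2 / C)"
    using dissipation_nonneg assms(3) by simp
  then show ?thesis
    using stability volume unfolding K B C by (simp add: right_diff_distrib)
qed

end
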